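(* Let $X$ be a finite set, let $\mathrm{FIM}_X$ be the free inverse monoid on $X$ and let $w\in \mathrm{Geo}(\mathrm{FIM}_X)$. Then $w\in \mathrm{UConjGeo}(\mathrm{FIM}_X)$ if and only if either $w$ is a word of length $2$ representing an idempotent, or there is no letter $x\in\tilde X = X\cup X^{-1}$ such that, in the Munn tree of $w$, there is a directed edge labelled $x$ starting at the initial vertex and also a directed edge labelled $x$ starting at the final vertex.
   Context: $\tilde X = X\cup X^{-1}$, where $X^{-1}=\{x^{-1}: x\in X\}$ is a disjoint copy of $X$ consisting of formal inverses; $\tilde X^*$ is the free monoid on $\tilde X$, $\ell(w)$ is the length of a word $w\in\tilde X^*$, and $\pi\colon \tilde X^*\to \mathrm{FIM}_X$ is the canonical surjective homomorphism. A word $w\in\tilde X^*$ is a geodesic if $\ell(w)\le \ell(u)$ for every $u\in \tilde X^*$ with $u\pi=w\pi$; $\mathrm{Geo}(\mathrm{FIM}_X)$ is the set of all geodesics. Two elements $a,b$ of an inverse monoid $S$ are conjugate ($i$-conjugate) if there is $g\in S$ with $g^{-1}ag=b$ and $gbg^{-1}=a$. This is an equivalence relation; $[a]$ denotes the conjugacy class of $a$, called trivial if $[a]=\{a\}$. $\mathrm{UConj}$ is the equivalence relation on $\mathrm{FIM}_X$ defined by: $(a,b)\in\mathrm{UConj}$ iff $a=b$, or both $[a]$ and $[b]$ are nontrivial. Then $\mathrm{UConjGeo}(\mathrm{FIM}_X)=\{w\in\mathrm{Geo}(\mathrm{FIM}_X): \ell(w)\le\ell(u)\text{ for all }u\in\mathrm{Geo}(\mathrm{FIM}_X)\text{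 with }(w\pi,u\pi)\in\mathrm{UConj}\}$. Munn tree of $w\in\tilde X^*$: the finite subtree of the Cayley graph of the free group on $X$ (with respect to $X$) traversed by the path labelled $w$ starting at the identity, i.e. its vertices are the elements of the free group represented by the prefixes of $w$; the initial vertex is the identity and the final vertex is the element of the free group represented by $w$. Each undirected edge gives two directed edges: if one direction is labelled $x\in\tilde X$, the opposite direction is labelled $x^{-1}$ (with $(x^{-1})^{-1}=x$). The initial and final vertices may coincide, in which case the two directed edges in the claim may be the same edge. Two words represent the same element of $\mathrm{FIM}_X$ iff they have the same Munn tree (with the same initial and final vertices). *)

theory Defs
  imports
    "HOL-Algebra.Group"
    "HOL-Library.Sublist"
    "Graph_Theory.Digraph_Component"
begin

section \<open>Monoid presentations\<close>

inductive_set presentation_cong :: "'b set \<Rightarrow> ('b list \<times> 'b list) set \<Rightarrow> ('b list \<times> 'b list) set"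
  for A R where
  rel: "(u, v) \<in> R \<Longrightarrow> u \<in> lists A \<Longrightarrow> v \<in> lists A \<Longrightarrow> (u, v) \<in> presentation_cong A R"
| refl: "u \<in> lists A \<Longrightarrow> (u, u) \<in> presentation_cong A R"
| sym: "(u, v) \<in> presentation_cong A R \<Longrightarrow> (v, u) \<in> presentation_cong A R"
| trans: "(u, v) \<in> presentation_cong A R \<Longrightarrow> (v, w) \<in> presentation_cong A R
    \<Longrightarrow> (u, w) \<in> presentation_cong A R"
| append: "(u, u') \<in> presentation_cong A R \<Longrightarrow> (v, v') \<in> presentation_cong A R
    \<Longrightarrow> (u @ v, u' @ v') \<in> presentation_cong A R"

definition presented_monoid :: "'b set \<Rightarrow> ('b list \<times> 'b list) set \<Rightarrow> 'b list set monoid" where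
  "presented_monoid A R =
    \<lparr>carrier = lists A // presentation_cong A R,
     monoid.mult = (\<lambda>P Q. \<Union>u\<in>P. \<Union>v\<in>Q. presentation_cong A R `` {u @ v}),
     one = presentation_cong A R `` {[]}\<rparr>"

lemma presentation_cong_subset:
  "(u, v) \<in> presentation_cong A R \<Longrightarrow> u \<in> lists A \<and> v \<in> lists A"
  by (induction rule: presentation_cong.induct) auto

lemma equiv_presentation_cong: "equiv (lists A) (presentation_cong A R)"
proof (rule equivI)
  show "presentation_cong A R \<subseteq> lists A \<times> lists A"
    using presentation_cong_subset by fastforce
  show "refl_on (lists A) (presentation_cong A R)"
    using presentation_cong_subset by (auto simp: refl_on_def intro: presentation_cong.refl)
  show "Relation.sym (presentation_cong A R)"
    by (auto intro!: symI presentation_cong.sym)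
  show "Relation.trans (presentation_cong A R)"
    by (auto intro!: transI intro: presentation_cong.trans)
qed

lemma presented_monoid_mult:
  assumes "u \<in> lists A" "v \<in> lists A"
  shows "presentation_cong A R `` {u} \<otimes>\<^bsub>presented_monoid A R\<^esub> presentation_cong A R `` {v}
    = presentation_cong A R `` {u @ v}"
proof -
  have eq: "presentation_cong A R `` {u' @ v'} = presentation_cong A R `` {u @ v}"
    if "(u, u') \<in> presentation_cong A R" "(v, v') \<in> presentation_cong A R" for u' v'
    using equiv_class_eq[OF equiv_presentation_cong presentation_cong.append[OF that]] by simp
  have "u \<in> presentation_cong A R `` {u}" "v \<in> presentation_cong A R `` {v}"
    using assms by (auto intro: presentation_cong.refl)
  then have ne: "presentation_cong A R `` {u} \<noteq> {}" "presentation_cong A R `` {v} \<noteq> {}"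
    by blast+
  have "(\<Union>u'\<in>presentation_cong A R `` {u}. \<Union>v'\<in>presentation_cong A R `` {v}.
        presentation_cong A R `` {u' @ v'})
      = (\<Union>u'\<in>presentation_cong A R `` {u}. \<Union>v'\<in>presentation_cong A R `` {v}.
        presentation_cong A R `` {u @ v})"
    by (intro SUP_cong HOL.refl eq) (simp_all only: Image_singleton_iff)
  also have "\<dots> = presentation_cong A R `` {u @ v}"
    by (simp only: UN_constant ne if_False)
  finally show ?thesis
    by (simp add: presented_monoid_def)
qed

lemma monoid_presented_monoid: "monoid (presented_monoid A R)"
proof -
  let ?M = "presented_monoid A R"
  have ex: "\<exists>u\<in>lists A. P = presentation_cong A R `` {u}" if "P \<in> carrier ?M" for P
    using that by (auto simp: presented_monoid_def quotient_def)
  have cl: "presentation_cong A R `` {u} \<in> carrier ?M" if "u \<in> lists A" for u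
    using that by (auto simp: presented_monoid_def quotient_def)
  have one: "\<one>\<^bsub>?M\<^esub> = presentation_cong A R `` {[]}"
    by (simp add: presented_monoid_def)
  show ?thesis
  proof
    fix P Q assume "P \<in> carrier ?M" "Q \<in> carrier ?M"
    then obtain u v where "u \<in> lists A" "v \<in> lists A"
      "P = presentation_cong A R `` {u}" "Q = presentation_cong A R `` {v}" by (metis ex)
    then show "P \<otimes>\<^bsub>?M\<^esub> Q \<in> carrier ?M"
      using cl[of "u @ v"] by (simp only: presented_monoid_mult append_in_lists_conv)
  next
    fix P Q S assume "P \<in> carrier ?M" "Q \<in> carrier ?M" "S \<in> carrier ?M"
    then obtain u v w where "u \<in> lists A" "v \<in> lists A" "w \<in> lists A"
      "P = presentation_cong A R `` {u}" "Q = presentation_cong A R `` {v}"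
      "S = presentation_cong A R `` {w}" by (metis ex)
    then show "P \<otimes>\<^bsub>?M\<^esub> Q \<otimes>\<^bsub>?M\<^esub> S = P \<otimes>\<^bsub>?M\<^esub> (Q \<otimes>\<^bsub>?M\<^esub> S)"
      by (simp only: presented_monoid_mult append_in_lists_conv append_assoc simp_thms)
  next
    show "\<one>\<^bsub>?M\<^esub> \<in> carrier ?M" using cl[of "[]"] one by simp
  next
    fix P assume "P \<in> carrier ?M"
    then obtain u where u: "u \<in> lists A" "P = presentation_cong A R `` {u}" by (metis ex)
    show "\<one>\<^bsub>?M\<^esub> \<otimes>\<^bsub>?M\<^esub> P = P" "P \<otimes>\<^bsub>?M\<^esub> \<one>\<^bsub>?M\<^esub> = P"
      using presented_monoid_mult[of "[]" A u R] presented_monoid_mult[of u A "[]" R] u one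
      by simp_all
  qed
qed

section \<open>Words over an alphabet and its formal inverses\<close>

text \<open>\<open>Neg x\<close> is the formal inverse of the generator \<open>x\<close>.\<close>

datatype 'a letter = Pos 'a | Neg 'a

primrec letter_inv :: "'a letter \<Rightarrow> 'a letter" where
  "letter_inv (Pos x) = Neg x"
| "letter_inv (Neg x) = Pos x"

definition letters :: "'a set \<Rightarrow> 'a letter set" where
  "letters X = Pos ` X \<union> Neg ` X"

abbreviation words :: "'a set \<Rightarrow> 'a letter list set" where
  "words X \<equiv> lists (letters X)"

definition word_inv :: "'a letter list \<Rightarrow> 'a letter list" where
  "word_inv w = rev (map letter_inv w)"

lemma letter_inv_letter_inv [simp]: "letter_inv (letter_inv x) = x"
  by (cases x) simp_all

lemma letter_inv_in_letters [simp]: "letter_inv x \<in> letters X \<longleftrightarrow> x \<in> letters X"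
  by (cases x) (auto simp: letters_def)

lemma set_word_inv [simp]: "set (word_inv w) = letter_inv ` set w"
  by (simp add: word_inv_def)

lemma word_inv_in_words: "w \<in> words X \<Longrightarrow> word_inv w \<in> words X"
  by auto

section \<open>Inverse monoids and conjugacy\<close>

definition is_inverse :: "('a, 'b) monoid_scheme \<Rightarrow> 'a \<Rightarrow> 'a \<Rightarrow> bool" where
  "is_inverse S a b \<longleftrightarrow> b \<in> carrier S \<and> a \<otimes>\<^bsub>S\<^esub> b \<otimes>\<^bsub>S\<^esub> a = a \<and> b \<otimes>\<^bsub>S\<^esub> a \<otimes>\<^bsub>S\<^esub> b = b"

locale inverse_monoid = monoid S for S (structure) +
  assumes ex1_inverse: "a \<in> carrier S \<Longrightarrow> \<exists>!b. is_inverse S a b"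

text \<open>The library's \<^const>\<open>m_inv\<close> is the two-sided inverse with respect to the unit, which is
  not the inverse of an inverse monoid.\<close>

definition im_inv :: "('a, 'b) monoid_scheme \<Rightarrow> 'a \<Rightarrow> 'a" where
  "im_inv S a = (THE b. is_inverse S a b)"

definition i_conj :: "('a, 'b) monoid_scheme \<Rightarrow> 'a \<Rightarrow> 'a \<Rightarrow> bool" where
  "i_conj S a b \<longleftrightarrow> a \<in> carrier S \<and> b \<in> carrier S \<and>
    (\<exists>g\<in>carrier S. im_inv S g \<otimes>\<^bsub>S\<^esub> a \<otimes>\<^bsub>S\<^esub> g = b \<and> g \<otimes>\<^bsub>S\<^esub> b \<otimes>\<^bsub>S\<^esub> im_inv S g = a)"

definition conj_class :: "('a, 'b) monoid_scheme \<Rightarrow> 'a \<Rightarrow> 'a set" where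
  "conj_class S a = {b. i_conj S a b}"

definition UConj :: "('a, 'b) monoid_scheme \<Rightarrow> ('a \<times> 'a) set" where
  "UConj S = {(a, b). a \<in> carrier S \<and> b \<in> carrier S \<and>
    (a = b \<or> conj_class S a \<noteq> {a} \<and> conj_class S b \<noteq> {b})}"

section \<open>The free inverse monoid and its geodesics\<close>

text \<open>The presentation of Vagner.\<close>

definition vagner_rels :: "'a set \<Rightarrow> ('a letter list \<times> 'a letter list) set" where
  "vagner_rels X =
    {(u @ word_inv u @ u, u) | u. u \<in> words X} \<union>
    {(u @ word_inv u @ v @ word_inv v, v @ word_inv v @ u @ word_inv u) | u v.
      u \<in> words X \<and> v \<in> words X}"

definition FIM :: "'a set \<Rightarrow> 'a letter list set monoid" where
  "FIM X = presented_monoid (letters X) (vagner_rels X)"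

definition fim_proj :: "'a set \<Rightarrow> 'a letter list \<Rightarrow> 'a letter list set" where
  "fim_proj X w = presentation_cong (letters X) (vagner_rels X) `` {w}"

definition Geo :: "'a set \<Rightarrow> 'a letter list set" where
  "Geo X = {w \<in> words X. \<forall>u\<in>words X. fim_proj X u = fim_proj X w \<longrightarrow> length w \<le> length u}"

definition UConjGeo :: "'a set \<Rightarrow> 'a letter list set" where
  "UConjGeo X = {w \<in> Geo X. \<forall>u\<in>Geo X.
    (fim_proj X w, fim_proj X u) \<in> UConj (FIM X) \<longrightarrow> length w \<le> length u}"

lemma carrier_FIM: "carrier (FIM X) = fim_proj X ` words X"
  by (auto simp: FIM_def fim_proj_def presented_monoid_def quotient_def)

lemma fim_proj_append:
  "u \<in> words X \<Longrightarrow> v \<in> words X \<Longrightarrow> fim_proj X (u @ v) = fim_proj X u \<otimes>\<^bsub>FIM X\<^esub> fim_proj X v"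
  by (simp add: FIM_def fim_proj_def presented_monoid_mult)

lemma fim_proj_Nil: "fim_proj X [] = \<one>\<^bsub>FIM X\<^esub>"
  by (simp add: FIM_def fim_proj_def presented_monoid_def)

lemma fim_proj_vagner_rels:
  assumes "(u, v) \<in> vagner_rels X"
  shows "fim_proj X u = fim_proj X v"
proof -
  have "u \<in> words X" "v \<in> words X"
    using assms by (auto simp: vagner_rels_def word_inv_in_words)
  with assms show ?thesis
    unfolding fim_proj_def
    by (intro equiv_class_eq[OF equiv_presentation_cong] presentation_cong.rel)
qed

theorem inverse_monoid_FIM: "inverse_monoid (FIM X)"
proof -
  interpret monoid "FIM X" unfolding FIM_def by (rule monoid_presented_monoid)
  let ?p = "fim_proj X" and ?i = "word_inv"
  have cl: "?p u \<in> carrier (FIM X)" if "u \<in> words X" for u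
    using that by (auto simp: carrier_FIM)
  have ii: "?i (?i u) = u" for u :: "'a letter list"
    by (simp add: word_inv_def rev_map comp_def)
  have reg: "?p u \<otimes>\<^bsub>FIM X\<^esub> ?p (?i u) \<otimes>\<^bsub>FIM X\<^esub> ?p u = ?p u" if "u \<in> words X" for u
  proof -
    have "?p (u @ ?i u @ u) = ?p u"
      using that by (intro fim_proj_vagner_rels) (auto simp: vagner_rels_def)
    then show ?thesis using that word_inv_in_words[OF that]
      by (simp add: fim_proj_append cl m_assoc)
  qed
  have com: "(?p u \<otimes>\<^bsub>FIM X\<^esub> ?p (?i u)) \<otimes>\<^bsub>FIM X\<^esub> (?p v \<otimes>\<^bsub>FIM X\<^esub> ?p (?i v))
      = (?p v \<otimes>\<^bsub>FIM X\<^esub> ?p (?i v)) \<otimes>\<^bsub>FIM X\<^esub> (?p u \<otimes>\<^bsub>FIM X\<^esub> ?p (?i u))"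
    if "u \<in> words X" "v \<in> words X" for u v
  proof -
    have "?p (u @ ?i u @ v @ ?i v) = ?p (v @ ?i v @ u @ ?i u)"
      using that by (intro fim_proj_vagner_rels) (auto simp: vagner_rels_def)
    then show ?thesis using that word_inv_in_words[OF that(1)] word_inv_in_words[OF that(2)]
      by (simp add: fim_proj_append cl m_assoc)
  qed
  have inv: "is_inverse (FIM X) (?p u) (?p (?i u))" if "u \<in> words X" for u
    using reg[OF that] reg[OF word_inv_in_words[OF that]] cl[OF word_inv_in_words[OF that]]
    by (simp add: is_inverse_def ii)
  have idem: "e = e \<otimes>\<^bsub>FIM X\<^esub> ?p (?i u) \<and> e = ?p (?i u)"
    if u: "u \<in> words X" and e: "e = ?p u" and ee: "e \<otimes>\<^bsub>FIM X\<^esub> e = e" for e u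
  proof -
    define f where "f = ?p (?i u)"
    have c: "e \<in> carrier (FIM X)" "f \<in> carrier (FIM X)"
      using u cl word_inv_in_words unfolding e f_def by blast+
    have efe: "e \<otimes>\<^bsub>FIM X\<^esub> f \<otimes>\<^bsub>FIM X\<^esub> e = e" and fef: "f \<otimes>\<^bsub>FIM X\<^esub> e \<otimes>\<^bsub>FIM X\<^esub> f = f"
      using inv[OF u] by (auto simp: is_inverse_def e f_def)
    have cc: "(e \<otimes>\<^bsub>FIM X\<^esub> f) \<otimes>\<^bsub>FIM X\<^esub> (f \<otimes>\<^bsub>FIM X\<^esub> e) = (f \<otimes>\<^bsub>FIM X\<^esub> e) \<otimes>\<^bsub>FIM X\<^esub> (e \<otimes>\<^bsub>FIM X\<^esub> f)"
      using com[OF u word_inv_in_words[OF u]] by (simp add: ii e f_def)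
    have "f = f \<otimes>\<^bsub>FIM X\<^esub> (e \<otimes>\<^bsub>FIM X\<^esub> e) \<otimes>\<^bsub>FIM X\<^esub> f" using fef ee by simp
    also have "\<dots> = (f \<otimes>\<^bsub>FIM X\<^esub> e) \<otimes>\<^bsub>FIM X\<^esub> (e \<otimes>\<^bsub>FIM X\<^esub> f)" using c by (simp add: m_assoc)
    also have "\<dots> = (e \<otimes>\<^bsub>FIM X\<^esub> f) \<otimes>\<^bsub>FIM X\<^esub> (f \<otimes>\<^bsub>FIM X\<^esub> e)" using cc by simp
    finally have f: "f = (e \<otimes>\<^bsub>FIM X\<^esub> f) \<otimes>\<^bsub>FIM X\<^esub> (f \<otimes>\<^bsub>FIM X\<^esub> e)" .
    have ef: "e \<otimes>\<^bsub>FIM X\<^esub> f = f" and fe: "f \<otimes>\<^bsub>FIM X\<^esub> e = f"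
    proof -
      have "e \<otimes>\<^bsub>FIM X\<^esub> f = e \<otimes>\<^bsub>FIM X\<^esub> ((e \<otimes>\<^bsub>FIM X\<^esub> f) \<otimes>\<^bsub>FIM X\<^esub> (f \<otimes>\<^bsub>FIM X\<^esub> e))"
        using f by simp
      also have "\<dots> = ((e \<otimes>\<^bsub>FIM X\<^esub> e) \<otimes>\<^bsub>FIM X\<^esub> f) \<otimes>\<^bsub>FIM X\<^esub> (f \<otimes>\<^bsub>FIM X\<^esub> e)"
        using c by (simp add: m_assoc)
      finally show "e \<otimes>\<^bsub>FIM X\<^esub> f = f" using ee f by simp
      have "f \<otimes>\<^bsub>FIM X\<^esub> e = ((e \<otimes>\<^bsub>FIM X\<^esub> f) \<otimes>\<^bsub>FIM X\<^esub> (f \<otimes>\<^bsub>FIM X\<^esub> e)) \<otimes>\<^bsub>FIM X\<^esub> e"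
        using f by simp
      also have "\<dots> = (e \<otimes>\<^bsub>FIM X\<^esub> f) \<otimes>\<^bsub>FIM X\<^esub> (f \<otimes>\<^bsub>FIM X\<^esub> (e \<otimes>\<^bsub>FIM X\<^esub> e))"
        using c by (simp add: m_assoc)
      finally show "f \<otimes>\<^bsub>FIM X\<^esub> e = f" using ee f by simp
    qed
    from efe ef fe have "e = f" by simp
    with ee show ?thesis by (simp add: f_def)
  qed
  have idcom: "e \<otimes>\<^bsub>FIM X\<^esub> f = f \<otimes>\<^bsub>FIM X\<^esub> e"
    if "e \<in> carrier (FIM X)" "f \<in> carrier (FIM X)" "e \<otimes>\<^bsub>FIM X\<^esub> e = e" "f \<otimes>\<^bsub>FIM X\<^esub> f = f" for e f
  proof -
    obtain u v where uv: "u \<in> words X" "v \<in> words X" "e = ?p u" "f = ?p v"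
      using \<open>e \<in> carrier (FIM X)\<close> \<open>f \<in> carrier (FIM X)\<close> by (auto simp: carrier_FIM)
    have "?p u \<otimes>\<^bsub>FIM X\<^esub> ?p (?i u) = e" "?p v \<otimes>\<^bsub>FIM X\<^esub> ?p (?i v) = f"
      using idem[OF uv(1,3) that(3)] idem[OF uv(2,4) that(4)]
      unfolding uv(3)[symmetric] uv(4)[symmetric] by argo+
    with com[OF uv(1,2)] show ?thesis by simp
  qed
  show ?thesis
  proof
    fix a assume "a \<in> carrier (FIM X)"
    then obtain u where u: "u \<in> words X" "a = ?p u" by (auto simp: carrier_FIM)
    have ac: "a \<in> carrier (FIM X)" by fact
    show "\<exists>!b. is_inverse (FIM X) a b"
    proof (rule ex1I[of _ "?p (?i u)"])
      show "is_inverse (FIM X) a (?p (?i u))" using inv u by simp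
    next
      fix b assume b: "is_inverse (FIM X) a b"
      define c where "c = ?p (?i u)"
      have c: "is_inverse (FIM X) a c" using inv u by (simp add: c_def)
      have bc: "b \<in> carrier (FIM X)" "c \<in> carrier (FIM X)" using b c by (auto simp: is_inverse_def)
      have B: "a \<otimes>\<^bsub>FIM X\<^esub> (b \<otimes>\<^bsub>FIM X\<^esub> a) = a" "b \<otimes>\<^bsub>FIM X\<^esub> (a \<otimes>\<^bsub>FIM X\<^esub> b) = b"
        and C: "a \<otimes>\<^bsub>FIM X\<^esub> (c \<otimes>\<^bsub>FIM X\<^esub> a) = a" "c \<otimes>\<^bsub>FIM X\<^esub> (a \<otimes>\<^bsub>FIM X\<^esub> c) = c"
        using b c ac bc by (auto simp: is_inverse_def m_assoc)
      have idp: "(x \<otimes>\<^bsub>FIM X\<^esub> y) \<otimes>\<^bsub>FIM X\<^esub> (x \<otimes>\<^bsub>FIM X\<^esub> y) = x \<otimes>\<^bsub>FIM X\<^esub> y"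
        if "x \<in> carrier (FIM X)" "y \<in> carrier (FIM X)" "x \<otimes>\<^bsub>FIM X\<^esub> (y \<otimes>\<^bsub>FIM X\<^esub> x) = x" for x y
      proof -
        have "(x \<otimes>\<^bsub>FIM X\<^esub> y) \<otimes>\<^bsub>FIM X\<^esub> (x \<otimes>\<^bsub>FIM X\<^esub> y) = (x \<otimes>\<^bsub>FIM X\<^esub> (y \<otimes>\<^bsub>FIM X\<^esub> x)) \<otimes>\<^bsub>FIM X\<^esub> y" using that(1,2) by (simp add: m_assoc)
        with that(3) show ?thesis by simp
      qed
      have "b \<otimes>\<^bsub>FIM X\<^esub> a = b \<otimes>\<^bsub>FIM X\<^esub> (a \<otimes>\<^bsub>FIM X\<^esub> (c \<otimes>\<^bsub>FIM X\<^esub> a))" using C by simp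
      also have "\<dots> = (b \<otimes>\<^bsub>FIM X\<^esub> a) \<otimes>\<^bsub>FIM X\<^esub> (c \<otimes>\<^bsub>FIM X\<^esub> a)" using ac bc by (simp add: m_assoc)
      also have "\<dots> = (c \<otimes>\<^bsub>FIM X\<^esub> a) \<otimes>\<^bsub>FIM X\<^esub> (b \<otimes>\<^bsub>FIM X\<^esub> a)" using B C ac bc by (intro idcom idp) simp_all
      also have "\<dots> = c \<otimes>\<^bsub>FIM X\<^esub> (a \<otimes>\<^bsub>FIM X\<^esub> (b \<otimes>\<^bsub>FIM X\<^esub> a))" using ac bc by (simp add: m_assoc)
      finally have e1: "b \<otimes>\<^bsub>FIM X\<^esub> a = c \<otimes>\<^bsub>FIM X\<^esub> a" using B by simp
      have "a \<otimes>\<^bsub>FIM X\<^esub> b = (a \<otimes>\<^bsub>FIM X\<^esub> (c \<otimes>\<^bsub>FIM X\<^esub> a)) \<otimes>\<^bsub>FIM X\<^esub> b" using C by simp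
      also have "\<dots> = (a \<otimes>\<^bsub>FIM X\<^esub> c) \<otimes>\<^bsub>FIM X\<^esub> (a \<otimes>\<^bsub>FIM X\<^esub> b)" using ac bc by (simp add: m_assoc)
      also have "\<dots> = (a \<otimes>\<^bsub>FIM X\<^esub> b) \<otimes>\<^bsub>FIM X\<^esub> (a \<otimes>\<^bsub>FIM X\<^esub> c)" using B C ac bc by (intro idcom idp) simp_all
      also have "\<dots> = (a \<otimes>\<^bsub>FIM X\<^esub> (b \<otimes>\<^bsub>FIM X\<^esub> a)) \<otimes>\<^bsub>FIM X\<^esub> c" using ac bc by (simp add: m_assoc)
      finally have e2: "a \<otimes>\<^bsub>FIM X\<^esub> b = a \<otimes>\<^bsub>FIM X\<^esub> c" using B by simp
      have "b = b \<otimes>\<^bsub>FIM X\<^esub> (a \<otimes>\<^bsub>FIM X\<^esub> c)" using B e2 by simp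
      also have "\<dots> = (b \<otimes>\<^bsub>FIM X\<^esub> a) \<otimes>\<^bsub>FIM X\<^esub> c" using ac bc by (simp add: m_assoc)
      also have "\<dots> = c \<otimes>\<^bsub>FIM X\<^esub> (a \<otimes>\<^bsub>FIM X\<^esub> c)" using e1 ac bc by (simp add: m_assoc)
      finally show "b = ?p (?i u)" using C by (simp add: c_def)
    qed
  qed
qed

section \<open>The free group, its Cayley graph, and Munn trees\<close>

definition FG :: "'a set \<Rightarrow> 'a letter list set monoid" where
  "FG X = presented_monoid (letters X) {([x, letter_inv x], []) | x. x \<in> letters X}"

definition fg_proj :: "'a set \<Rightarrow> 'a letter list \<Rightarrow> 'a letter list set" where
  "fg_proj X w =
    presentation_cong (letters X) {([x, letter_inv x], []) | x. x \<in> letters X} `` {w}"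

text \<open>The arc \<open>(g, x)\<close> is the directed edge from \<open>g\<close> to \<open>gx\<close> labelled \<open>x\<close>.\<close>

type_synonym 'a fg_arc = "'a letter list set \<times> 'a letter"

definition cayley_graph :: "'a set \<Rightarrow> ('a letter list set, 'a fg_arc) pre_digraph" where
  "cayley_graph X =
    \<lparr>verts = carrier (FG X), arcs = carrier (FG X) \<times> letters X,
     tail = fst, head = (\<lambda>(g, x). g \<otimes>\<^bsub>FG X\<^esub> fg_proj X [x])\<rparr>"

abbreviation label :: "'a fg_arc \<Rightarrow> 'a letter" where
  "label \<equiv> snd"

text \<open>Every edge traversed by the path labelled \<open>w\<close> contributes both of its directions.\<close>

definition munn_tree :: "'a set \<Rightarrow> 'a letter list \<Rightarrow> ('a letter list set, 'a fg_arc) pre_digraph" where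
  "munn_tree X w =
    \<lparr>verts = {fg_proj X u | u. prefix u w},
     arcs = {(fg_proj X u, x) | u x. prefix (u @ [x]) w} \<union>
            {(fg_proj X (u @ [x]), letter_inv x) | u x. prefix (u @ [x]) w},
     tail = tail (cayley_graph X), head = head (cayley_graph X)\<rparr>"

definition initial_vertex :: "'a set \<Rightarrow> 'a letter list \<Rightarrow> 'a letter list set" where
  "initial_vertex X w = \<one>\<^bsub>FG X\<^esub>"

definition final_vertex :: "'a set \<Rightarrow> 'a letter list \<Rightarrow> 'a letter list set" where
  "final_vertex X w = fg_proj X w"

lemma fg_proj_append:
  "u \<in> words X \<Longrightarrow> v \<in> words X \<Longrightarrow> fg_proj X (u @ v) = fg_proj X u \<otimes>\<^bsub>FG X\<^esub> fg_proj X v"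
  by (simp add: FG_def fg_proj_def presented_monoid_mult)

lemma carrier_FG: "carrier (FG X) = fg_proj X ` words X"
  by (auto simp: FG_def fg_proj_def presented_monoid_def quotient_def)

lemma fg_proj_cancel:
  assumes "u \<in> words X" "x \<in> letters X"
  shows "fg_proj X (u @ [x, letter_inv x]) = fg_proj X u"
proof -
  have "(u @ [x, letter_inv x], u @ []) \<in>
      presentation_cong (letters X) {([x, letter_inv x], []) | x. x \<in> letters X}"
    using assms by (intro presentation_cong.append presentation_cong.refl presentation_cong.rel) auto
  then show ?thesis
    unfolding fg_proj_def by (simp add: equiv_class_eq[OF equiv_presentation_cong])
qed

lemma subgraph_munn_tree:
  assumes "w \<in> words X"
  shows "subgraph (munn_tree X w) (cayley_graph X)"
proof -
  have P: "u \<in> words X" if "prefix u w" for u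
    using that assms by (auto simp: prefix_def)
  have H: "fg_proj X u \<otimes>\<^bsub>FG X\<^esub> fg_proj X [x] = fg_proj X (u @ [x])"
    if "u \<in> words X" "x \<in> letters X" for u x
    using that by (simp add: fg_proj_append)
  have K: "fg_proj X (u @ [x]) \<otimes>\<^bsub>FG X\<^esub> fg_proj X [letter_inv x] = fg_proj X u"
    if "u \<in> words X" "x \<in> letters X" for u x
    using that H[of "u @ [x]" "letter_inv x"] fg_proj_cancel[OF that] by simp
  have wfc: "wf_digraph (cayley_graph X)"
  proof
    fix e assume "e \<in> arcs (cayley_graph X)"
    then obtain u x where e: "u \<in> words X" "x \<in> letters X" "e = (fg_proj X u, x)"
      unfolding cayley_graph_def carrier_FG by auto
    then show "tail (cayley_graph X) e \<in> verts (cayley_graph X)"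
      by (simp add: cayley_graph_def carrier_FG)
    have "u @ [x] \<in> words X" using e by simp
    then have "fg_proj X (u @ [x]) \<in> fg_proj X ` words X" by (rule imageI)
    then show "head (cayley_graph X) e \<in> verts (cayley_graph X)"
      using e H[OF e(1,2)] by (simp add: cayley_graph_def carrier_FG)
  qed
  have wfm: "wf_digraph (munn_tree X w)"
  proof
    fix e assume e: "e \<in> arcs (munn_tree X w)"
    then obtain u x where ux: "prefix (u @ [x]) w"
      and d: "e = (fg_proj X u, x) \<or> e = (fg_proj X (u @ [x]), letter_inv x)"
      by (auto simp: munn_tree_def)
    have u: "prefix u w" "u \<in> words X" "x \<in> letters X"
      using ux P[OF ux] by (auto dest: append_prefixD)
    show "tail (munn_tree X w) e \<in> verts (munn_tree X w)"
      using d ux u by (auto simp: munn_tree_def cayley_graph_def)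
    show "head (munn_tree X w) e \<in> verts (munn_tree X w)"
      using d ux u H[of u x] K[of u x] by (auto simp: munn_tree_def cayley_graph_def)
  qed
  have "verts (munn_tree X w) \<subseteq> verts (cayley_graph X)"
    using P by (auto simp: munn_tree_def cayley_graph_def carrier_FG)
  moreover have "arcs (munn_tree X w) \<subseteq> arcs (cayley_graph X)"
    using P by (fastforce simp: munn_tree_def cayley_graph_def carrier_FG dest: append_prefixD)
  ultimately show ?thesis
    using wfc wfm by (simp add: subgraph_def compatible_def munn_tree_def)
qed

end

theory Submission
  imports Defs
begin

text \<open>
  The class of \<open>w\<close> is nontrivial exactly when some letter \<open>x\<close> leaves both the initial and
  the final vertex of its Munn tree. If \<open>h\<inverse> w h \<noteq> w\<close> while \<open>h h\<inverse> w h h\<inverse> = w\<close>, then the tree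
  contains the path labelled \<open>h\<close> at both vertices, so the first letter of \<open>h\<close> is such an \<open>x\<close>.
  Conversely, such an \<open>x\<close> is absorbed, \<open>x x\<inverse> w x x\<inverse> = w\<close>, because a word that is trivial
  in the free group is idempotent in the free inverse monoid; so \<open>x\<inverse> w x\<close> is conjugate to \<open>w\<close>,
  and it differs from \<open>w\<close>. The elements with nontrivial classes form a single class of the
  equivalence, whose shortest words are the \<open>y y\<inverse>\<close> of length 2.
\<close>

section \<open>Formal inverses of words\<close>

lemma word_inv_simps [simp]:
  "word_inv [] = []" "word_inv (x # u) = word_inv u @ [letter_inv x]"
  "word_inv (u @ v) = word_inv v @ word_inv u"
  by (simp_all add: word_inv_def)

lemma word_inv_word_inv [simp]: "word_inv (word_inv u) = u"
  by (induction u) simp_all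

lemma letter_inv_neq [simp]: "letter_inv x \<noteq> x" "x \<noteq> letter_inv x"
  by (cases x; simp)+

lemma letter_inv_eq_iff [simp]: "letter_inv x = letter_inv y \<longleftrightarrow> x = y"
  by (metis letter_inv_letter_inv)

lemma word_inv_in_words_iff [simp]: "word_inv u \<in> words X \<longleftrightarrow> u \<in> words X"
  using word_inv_in_words word_inv_word_inv by metis

section \<open>The free group\<close>

abbreviation fg_rels :: "'a set \<Rightarrow> ('a letter list \<times> 'a letter list) set" where
  "fg_rels X \<equiv> {([x, letter_inv x], []) | x. x \<in> letters X}"

lemma fg_proj_eqD:
  assumes "fg_proj X u = fg_proj X v" "v \<in> words X"
  shows "(u, v) \<in> presentation_cong (letters X) (fg_rels X)"
  using assms unfolding fg_proj_def
  by (metis (no_types, lifting) Image_singleton_iff presentation_cong.refl)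

lemma monoid_FG: "monoid (FG X)"
  unfolding FG_def by (rule monoid_presented_monoid)

lemma fg_proj_Nil: "fg_proj X [] = \<one>\<^bsub>FG X\<^esub>"
  by (simp add: FG_def fg_proj_def presented_monoid_def)

lemma fg_proj_closed [simp]: "u \<in> words X \<Longrightarrow> fg_proj X u \<in> carrier (FG X)"
  by (simp add: carrier_FG)

lemma fg_proj_word_inv:
  assumes "u \<in> words X"
  shows "fg_proj X (u @ word_inv u) = \<one>\<^bsub>FG X\<^esub>"
  using assms
proof (induction u rule: rev_induct)
  case (snoc x u)
  have u: "u \<in> words X" "x \<in> letters X" using snoc.prems by simp_all
  have "fg_proj X ((u @ [x]) @ word_inv (u @ [x]))
      = fg_proj X (u @ [x, letter_inv x]) \<otimes>\<^bsub>FG X\<^esub> fg_proj X (word_inv u)"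
    using u fg_proj_append[of "u @ [x, letter_inv x]" X "word_inv u"]
    by simp
  also have "\<dots> = fg_proj X (u @ word_inv u)"
    using u by (simp only: fg_proj_cancel fg_proj_append word_inv_in_words_iff)
  finally show ?case using snoc.IH[OF u(1)] by simp
qed (simp add: fg_proj_Nil)

text \<open>On words, this is the homomorphism from the free group to the integers that sends
  \<open>x\<close> to 1 and the generators other than \<open>x\<close> and its inverse to 0. It
  separates vertices of the Cayley graph without normal forms.\<close>

definition exponent_sum :: "'a letter \<Rightarrow> 'a letter list \<Rightarrow> int" where
  "exponent_sum x u = int (count_list u x) - int (count_list u (letter_inv x))"

lemma exponent_sum_fg_proj:
  assumes "fg_proj X u = fg_proj X v" "v \<in> words X"
  shows "exponent_sum y u = exponent_sum y v"
  using fg_proj_eqD[OF assms]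
proof (induction rule: presentation_cong.induct)
  case (rel u v)
  then show ?case by (auto simp: exponent_sum_def)
qed (simp_all add: exponent_sum_def)

section \<open>Free reduction\<close>

fun reduced :: "'a letter list \<Rightarrow> bool" where
  "reduced (x # y # u) \<longleftrightarrow> y \<noteq> letter_inv x \<and> reduced (y # u)"
| "reduced _ \<longleftrightarrow> True"

text \<open>Left multiplication by one letter on reduced words; folding it over a word with start
  value \<open>[]\<close> yields the reduced form.\<close>

fun cons_reduce :: "'a letter \<Rightarrow> 'a letter list \<Rightarrow> 'a letter list" where
  "cons_reduce x (y # u) = (if y = letter_inv x then u else x # y # u)"
| "cons_reduce x [] = [x]"

lemma reduced_cons_reduce: "reduced u \<Longrightarrow> reduced (cons_reduce x u)"
  by (induction u rule: reduced.induct) auto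

lemma reduced_foldr: "reduced r \<Longrightarrow> reduced (foldr cons_reduce u r)"
  by (induction u) (simp_all add: reduced_cons_reduce)

text \<open>Reducedness matters: if \<open>u\<close> began with \<open>x\<close> and then its
  inverse, both letters would be lost.\<close>

lemma cons_reduce_cancel:
  "reduced u \<Longrightarrow> cons_reduce x (cons_reduce (letter_inv x) u) = u"
  by (induction u rule: reduced.induct) auto

text \<open>Van der Waerden's argument: \<open>x\<close> and its inverse act as mutually inverse
  permutations of the reduced words, so the free group acts on them.\<close>

lemma foldr_cons_reduce_cong:
  assumes "(u, v) \<in> presentation_cong (letters X) (fg_rels X)" "reduced r"
  shows "foldr cons_reduce u r = foldr cons_reduce v r"
  using assms
proof (induction arbitrary: r rule: presentation_cong.induct)
  case (rel u v)
  then show ?case by (auto simp: cons_reduce_cancel)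
qed (simp_all add: reduced_foldr)

section \<open>Words that are trivial in the free group\<close>

lemma fim_proj_closed [simp]: "u \<in> words X \<Longrightarrow> fim_proj X u \<in> carrier (FIM X)"
  by (simp add: carrier_FIM)

lemma monoid_FIM: "monoid (FIM X)"
  unfolding FIM_def by (rule monoid_presented_monoid)

lemma fim_proj_eqD:
  assumes "fim_proj X u = fim_proj X v" "v \<in> words X"
  shows "(u, v) \<in> presentation_cong (letters X) (vagner_rels X)"
  using assms unfolding fim_proj_def
  by (metis (no_types, lifting) Image_singleton_iff presentation_cong.refl)

lemma fim_proj_context:
  assumes "fim_proj X u = fim_proj X v" "p \<in> words X" "q \<in> words X" "u \<in> words X" "v \<in> words X"
  shows "fim_proj X (p @ u @ q) = fim_proj X (p @ v @ q)"
  using assms fim_proj_append[of p X "u @ q"] fim_proj_append[of p X "v @ q"]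
  by (simp add: fim_proj_append)

lemma fim_proj_regular: "u \<in> words X \<Longrightarrow> fim_proj X (u @ word_inv u @ u) = fim_proj X u"
  by (intro fim_proj_vagner_rels) (auto simp: vagner_rels_def)

lemma fim_proj_commute:
  "u \<in> words X \<Longrightarrow> v \<in> words X \<Longrightarrow>
    fim_proj X (u @ word_inv u @ v @ word_inv v) = fim_proj X (v @ word_inv v @ u @ word_inv u)"
  by (intro fim_proj_vagner_rels) (auto simp: vagner_rels_def)

text \<open>Insert \<open>letter_inv x, x\<close> after \<open>x\<close> by regularity and commute
  it past \<open>p @ word_inv p\<close>. Thus a letter moves to the right of an idempotent, which is
  replaced by its conjugate.\<close>

lemma fim_proj_left_idem:
  assumes "p \<in> words X" "x \<in> letters X" "r \<in> words X"
  shows "fim_proj X (x # p @ word_inv p @ r) = fim_proj X ((x # p) @ word_inv (x # p) @ x # r)"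
proof -
  note [simp] = assms
  have "fim_proj X (x # p @ word_inv p @ r)
      = fim_proj X ([x, letter_inv x, x] @ p @ word_inv p @ r)"
    using fim_proj_context[OF fim_proj_regular[of "[x]" X], of "[]" "p @ word_inv p @ r"]
    by simp
  also have "\<dots> = fim_proj X ([x] @ (p @ word_inv p @ [letter_inv x, x]) @ r)"
    using fim_proj_context[OF fim_proj_commute[of "[letter_inv x]" X p], of "[x]" r]
    by simp
  finally show ?thesis by simp
qed

text \<open>Each element is an idempotent times a reduced word. Letters are added on the left and
  moved past the idempotent; whatever cancels is stored in it.\<close>

lemma fim_proj_reduce:
  assumes "u \<in> words X"
  shows "\<exists>p\<in>words X. foldr cons_reduce u [] \<in> words X \<and>
    fim_proj X u = fim_proj X (p @ word_inv p @ foldr cons_reduce u [])"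
  using assms
proof (induction u rule: list.induct)
  case Nil
  show ?case by (rule bexI[of _ "[]"]) simp_all
next
  case (Cons x u)
  let ?r = "foldr cons_reduce u []"
  have ux: "u \<in> words X" "x \<in> letters X" using Cons.prems by simp_all
  then obtain p where p: "p \<in> words X" "?r \<in> words X"
    "fim_proj X u = fim_proj X (p @ word_inv p @ ?r)" using Cons.IH by blast
  note [simp] = ux p(1,2)
  have eq: "fim_proj X (x # u) = fim_proj X ((x # p) @ word_inv (x # p) @ x # ?r)"
    using fim_proj_context[OF p(3), of "[x]" "[]"] fim_proj_left_idem[OF p(1) ux(2) p(2)]
    by simp
  show ?case
  proof (cases "\<exists>s. ?r = letter_inv x # s")
    case True
    then obtain s where s: "?r = letter_inv x # s" by blast
    define q where "q = x # p"
    \<comment> \<open>After \<open>x\<close> meets \<open>letter_inv x\<close>, the idempotents of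
      \<open>q\<close> and of \<open>[x]\<close> stand side by side. This \<open>t\<close> merges
      them: \<open>t @ word_inv t\<close> represents their product.\<close>
    define t where "t = q @ word_inv q @ [x]"
    have q: "q \<in> words X" "word_inv q \<in> words X" "s \<in> words X"
      using p(2) unfolding s q_def by simp_all
    have "fim_proj X (t @ word_inv t @ s)
        = fim_proj X ((q @ word_inv q) @ ([x] @ word_inv [x] @ q @ word_inv q) @ s)"
      by (simp add: t_def)
    also have "\<dots> = fim_proj X ((q @ word_inv q) @ (q @ word_inv q @ [x] @ word_inv [x]) @ s)"
      by (rule fim_proj_context[OF fim_proj_commute])
        (use q in simp_all)
    also have "\<dots> = fim_proj X ([] @ (q @ word_inv q @ q) @ word_inv q @ [x, letter_inv x] @ s)"
      by simp
    also have "\<dots> = fim_proj X ([] @ q @ word_inv q @ [x, letter_inv x] @ s)"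
      by (rule fim_proj_context[OF fim_proj_regular])
        (use q in simp_all)
    also have "\<dots> = fim_proj X (x # u)" using eq by (simp add: s q_def)
    finally have "fim_proj X (x # u) = fim_proj X (t @ word_inv t @ s)" by simp
    moreover have "t \<in> words X" using q by (simp add: t_def)
    ultimately show ?thesis using q(3) s by (intro bexI[of _ t]) simp_all
  next
    case False
    then have "cons_reduce x ?r = x # ?r" by (cases ?r) auto
    then show ?thesis
      using eq by (intro bexI[of _ "x # p"]) simp_all
  qed
qed

text \<open>The reduced form is empty, so only the idempotent factor is left. This says that the
  free inverse monoid is E-unitary.\<close>

lemma fim_proj_of_fg_trivial:
  assumes "u \<in> words X" "fg_proj X u = \<one>\<^bsub>FG X\<^esub>"
  obtains p where "p \<in> words X" "fim_proj X u = fim_proj X (p @ word_inv p)"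
proof -
  have "(u, []) \<in> presentation_cong (letters X) (fg_rels X)"
    using assms by (intro fg_proj_eqD) (simp_all add: fg_proj_Nil)
  then have "foldr cons_reduce u [] = []"
    using foldr_cons_reduce_cong[of u "[]" X "[]"] by simp
  with fim_proj_reduce[OF assms(1)] that show ?thesis by auto
qed

lemma im_inv_fim_proj:
  assumes "u \<in> words X"
  shows "im_inv (FIM X) (fim_proj X u) = fim_proj X (word_inv u)"
proof -
  interpret inverse_monoid "FIM X" by (rule inverse_monoid_FIM)
  note [simp] = assms
  have "is_inverse (FIM X) (fim_proj X u) (fim_proj X (word_inv u))"
    using fim_proj_regular[of u X] fim_proj_regular[of "word_inv u" X]
    by (simp add: is_inverse_def fim_proj_append m_assoc)
  then show ?thesis
    unfolding im_inv_def by (rule the1_equality[OF ex1_inverse[OF fim_proj_closed[OF assms]]])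
qed

lemma fim_proj_word_inv_cong:
  "u \<in> words X \<Longrightarrow> v \<in> words X \<Longrightarrow> fim_proj X u = fim_proj X v \<Longrightarrow>
    fim_proj X (word_inv u) = fim_proj X (word_inv v)"
  by (metis im_inv_fim_proj)

section \<open>Arcs of Munn trees\<close>

abbreviation munn_arcs :: "'a set \<Rightarrow> 'a letter list \<Rightarrow> 'a fg_arc set" where
  "munn_arcs X w \<equiv> arcs (munn_tree X w)"

text \<open>The left action of the free group on its Cayley graph, which preserves labels.\<close>

definition translate :: "'a set \<Rightarrow> 'a letter list \<Rightarrow> 'a fg_arc \<Rightarrow> 'a fg_arc" where
  "translate X u = (\<lambda>(g, x). (fg_proj X u \<otimes>\<^bsub>FG X\<^esub> g, x))"

lemma munn_arcs_Nil: "munn_arcs X [] = {}"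
  by (simp add: munn_tree_def)

lemma translate_fg_proj:
  "u \<in> words X \<Longrightarrow> v \<in> words X \<Longrightarrow> translate X u (fg_proj X v, x) = (fg_proj X (u @ v), x)"
  by (simp add: translate_def fg_proj_append)

lemma munn_arcs_Cons:
  assumes "w \<in> words X" "x \<in> letters X"
  shows "munn_arcs X (x # w) =
    {(\<one>\<^bsub>FG X\<^esub>, x), (fg_proj X [x], letter_inv x)} \<union> translate X [x] ` munn_arcs X w"
proof -
  let ?P = "\<lambda>w. {(u, y). prefix (u @ [y]) w}"
  \<comment> \<open>A pair in \<open>?P\<close> is a position in the word: the prefix read so far
    and the next letter. \<open>?f\<close> gives the arc traversed there, \<open>?g\<close> its
    reverse.\<close>
  let ?f = "\<lambda>e. (fg_proj X (fst e), snd e)"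
  let ?g = "\<lambda>e. (fg_proj X (fst e @ [snd e]), letter_inv (snd e))"
  have arcs: "munn_arcs X v = ?f ` ?P v \<union> ?g ` ?P v" for v
    unfolding munn_tree_def pre_digraph.simps by (intro arg_cong2[where f = "(\<union>)"]) force+
  have "prefix (u @ [y]) (x # w) \<longleftrightarrow> u = [] \<and> y = x \<or> (\<exists>v. u = x # v \<and> prefix (v @ [y]) w)" for u y
    by (cases u) auto
  then have P: "?P (x # w) = insert ([], x) ((\<lambda>e. (x # fst e, snd e)) ` ?P w)"
    by (auto simp: image_iff)
  have W: "fst e \<in> words X \<and> snd e \<in> letters X" if "e \<in> ?P w" for e
    using that assms(1) by (auto simp: prefix_def)
  have f: "?f ` (\<lambda>e. (x # fst e, snd e)) ` ?P w = translate X [x] ` ?f ` ?P w"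
    unfolding image_image
    by (rule image_cong[OF HOL.refl]) (use W assms(2) in \<open>simp add: translate_fg_proj\<close>)
  have g: "?g ` (\<lambda>e. (x # fst e, snd e)) ` ?P w = translate X [x] ` ?g ` ?P w"
    unfolding image_image
    by (rule image_cong[OF HOL.refl]) (use W assms(2) in \<open>simp add: translate_fg_proj\<close>)
  show ?thesis
    unfolding arcs P image_insert image_Un f g by (auto simp: fg_proj_Nil)
qed

lemma finite_munn_arcs: "w \<in> words X \<Longrightarrow> finite (munn_arcs X w)"
  by (induction w) (simp_all add: munn_arcs_Nil munn_arcs_Cons)

lemma munn_arcs_in_carrier: "w \<in> words X \<Longrightarrow> munn_arcs X w \<subseteq> carrier (FG X) \<times> UNIV"
proof (induction w)
  case (Cons x w)
  interpret monoid "FG X" by (rule monoid_FG)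
  show ?case using Cons by (auto simp: munn_arcs_Cons translate_def)
qed (simp add: munn_arcs_Nil)

lemma translate_translate:
  assumes "u \<in> words X" "v \<in> words X" "e \<in> carrier (FG X) \<times> UNIV"
  shows "translate X u (translate X v e) = translate X (u @ v) e"
proof -
  interpret monoid "FG X" by (rule monoid_FG)
  show ?thesis using assms by (cases e) (simp add: translate_def fg_proj_append m_assoc)
qed

lemma image_translate_translate:
  assumes "u \<in> words X" "v \<in> words X" "w \<in> words X"
  shows "translate X u ` translate X v ` munn_arcs X w = translate X (u @ v) ` munn_arcs X w"
  unfolding image_image using assms munn_arcs_in_carrier
  by (intro image_cong HOL.refl translate_translate) blast+

lemma image_translate_trivial:
  assumes "fg_proj X u = \<one>\<^bsub>FG X\<^esub>" "w \<in> words X"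
  shows "translate X u ` munn_arcs X w = munn_arcs X w"
proof -
  interpret monoid "FG X" by (rule monoid_FG)
  have "translate X u e = e" if "e \<in> munn_arcs X w" for e
    using that assms munn_arcs_in_carrier[OF assms(2)] by (auto simp: translate_def)
  then show ?thesis by simp
qed

lemma munn_arcs_append:
  assumes "u \<in> words X" "v \<in> words X"
  shows "munn_arcs X (u @ v) = munn_arcs X u \<union> translate X u ` munn_arcs X v"
  using assms(1)
proof (induction u rule: list.induct)
  case Nil
  then show ?case using assms(2) by (simp add: munn_arcs_Nil image_translate_trivial fg_proj_Nil)
next
  case (Cons x u)
  then show ?case
    using assms(2) image_translate_translate[of "[x]" X u v]
    by (simp add: munn_arcs_Cons image_Un Un_assoc)
qed

text \<open>Reading \<open>u\<close> backwards from its end vertex traverses the same edges, and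
  each edge contributes both directions.\<close>

lemma munn_arcs_word_inv:
  assumes "u \<in> words X"
  shows "translate X u ` munn_arcs X (word_inv u) = munn_arcs X u"
  using assms
proof (induction u rule: list.induct)
  case (Cons x u)
  have [simp]: "x \<in> letters X" "u \<in> words X"
    using Cons.prems by simp_all
  have "munn_arcs X (word_inv (x # u)) =
      munn_arcs X (word_inv u) \<union> translate X (word_inv u) ` munn_arcs X [letter_inv x]"
    using munn_arcs_append[of "word_inv u" X "[letter_inv x]"] by simp
  then have "translate X (x # u) ` munn_arcs X (word_inv (x # u)) =
      translate X [x] ` translate X u ` munn_arcs X (word_inv u) \<union>
      translate X [x] ` translate X (u @ word_inv u) ` munn_arcs X [letter_inv x]"
    by (simp add: image_Un image_translate_translate)
  also have "\<dots> = translate X [x] ` munn_arcs X u \<union> translate X [x] ` munn_arcs X [letter_inv x]"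
    using Cons.IH by (simp add: image_translate_trivial fg_proj_word_inv)
  also have "translate X [x] ` munn_arcs X [letter_inv x] =
      {(\<one>\<^bsub>FG X\<^esub>, x), (fg_proj X [x], letter_inv x)}"
    using translate_fg_proj[of "[x]" X "[]"] translate_fg_proj[of "[x]" X "[letter_inv x]"]
      fg_proj_cancel[of "[]" X x]
    by (auto simp: munn_arcs_Cons munn_arcs_Nil fg_proj_Nil)
  finally show ?case by (simp add: munn_arcs_Cons Un_commute)
qed (simp add: munn_arcs_Nil)

lemma munn_arcs_idem:
  assumes "u \<in> words X" "v \<in> words X"
  shows "munn_arcs X (u @ word_inv u @ v) = munn_arcs X u \<union> munn_arcs X v"
proof -
  have "munn_arcs X (u @ word_inv u @ v)
      = munn_arcs X u \<union> (translate X u ` munn_arcs X (word_inv u) \<union>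
        translate X (u @ word_inv u) ` munn_arcs X v)"
    using assms by (simp add: munn_arcs_append image_Un image_translate_translate)
  then show ?thesis
    using assms by (simp add: munn_arcs_word_inv image_translate_trivial fg_proj_word_inv)
qed

text \<open>The invariance half of Munn's theorem. A factor \<open>p @ word_inv p\<close> returns to
  its starting vertex and only adds the arcs of \<open>p\<close>, so the Vagner relations reduce to
  idempotence and commutativity of union.\<close>

lemma munn_arcs_fg_cong:
  assumes "(u, v) \<in> presentation_cong (letters X) (vagner_rels X)"
  shows "munn_arcs X u = munn_arcs X v \<and> fg_proj X u = fg_proj X v"
  using assms
proof (induction rule: presentation_cong.induct)
  case (rel u v)
  interpret monoid "FG X" by (rule monoid_FG)
  have fg: "fg_proj X (p @ word_inv p @ q) = fg_proj X q" if "p \<in> words X" "q \<in> words X" for p q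
  proof -
    have "fg_proj X ((p @ word_inv p) @ q) = fg_proj X (p @ word_inv p) \<otimes>\<^bsub>FG X\<^esub> fg_proj X q"
      by (rule fg_proj_append) (simp_all add: that)
    also have "\<dots> = fg_proj X q" using that by (simp only: fg_proj_word_inv fg_proj_closed l_one)
    finally show ?thesis by simp
  qed
  have mi: "munn_arcs X (p @ word_inv p) = munn_arcs X p" if "p \<in> words X" for p
    using munn_arcs_idem[OF that, of "[]"] by (simp add: munn_arcs_Nil)
  from rel(1) consider "v \<in> words X" "u = v @ word_inv v @ v"
    | p q where "p \<in> words X" "q \<in> words X"
      "u = p @ word_inv p @ q @ word_inv q" "v = q @ word_inv q @ p @ word_inv p"
    unfolding vagner_rels_def by blast
  then show ?case
    by cases (simp_all add: munn_arcs_idem mi fg fg_proj_word_inv Un_commute)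
next
  case (append u u' v v')
  note presentation_cong_subset[OF append(1)] presentation_cong_subset[OF append(2)]
  moreover have "translate X u = translate X u'" using append by (simp add: translate_def)
  ultimately show ?case using append by (simp add: munn_arcs_append fg_proj_append)
qed simp_all

lemma munn_arcs_fim_cong:
  "fim_proj X u = fim_proj X v \<Longrightarrow> v \<in> words X \<Longrightarrow> munn_arcs X u = munn_arcs X v"
  using munn_arcs_fg_cong fim_proj_eqD by blast

text \<open>The path of \<open>w\<close> traverses the given edge in one direction or the other. The
  prefix that ends at the identity is idempotent, so \<open>x\<close> and its inverse can be
  commuted past it to that traversal, where regularity absorbs them.\<close>

lemma fim_proj_absorb_left:
  assumes w: "w \<in> words X" and arc: "(\<one>\<^bsub>FG X\<^esub>, x) \<in> munn_arcs X w"
  shows "fim_proj X ([x, letter_inv x] @ w) = fim_proj X w"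
proof -
  obtain u y where "prefix (u @ [y]) w"
    and c: "fg_proj X u = \<one>\<^bsub>FG X\<^esub> \<and> y = x \<or> fg_proj X (u @ [y]) = \<one>\<^bsub>FG X\<^esub> \<and> x = letter_inv y"
    using arc unfolding munn_tree_def pre_digraph.simps by (smt (verit) UnE mem_Collect_eq prod.inject)
  then obtain v where d: "w = u @ [y] @ v" by (auto simp: prefix_def)
  have uv [simp]: "u \<in> words X" "y \<in> letters X" "v \<in> words X" using w d by simp_all
  have key: "fim_proj X ([x, letter_inv x] @ s @ t) = fim_proj X (s @ [x, letter_inv x] @ t)"
    if s: "s \<in> words X" "fg_proj X s = \<one>\<^bsub>FG X\<^esub>" and t: "t \<in> words X" and x: "x \<in> letters X" for s t
  proof -
    obtain p where p: "p \<in> words X" "fim_proj X s = fim_proj X (p @ word_inv p)"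
      using fim_proj_of_fg_trivial[OF s] .
    note [simp] = p(1) s(1) t x
    have "fim_proj X ([x, letter_inv x] @ s @ t)
        = fim_proj X ([x, letter_inv x] @ (p @ word_inv p) @ t)"
      using p(2) by (rule fim_proj_context) simp_all
    also have "\<dots> = fim_proj X ((p @ word_inv p) @ [x, letter_inv x] @ t)"
      using fim_proj_context[OF fim_proj_commute[of "[x]" X p], of "[]" t] by simp
    also have "\<dots> = fim_proj X (s @ [x, letter_inv x] @ t)"
      using fim_proj_context[OF p(2), of "[]" "[x, letter_inv x] @ t"] by simp
    finally show ?thesis .
  qed
  \<comment> \<open>This serves both directions: the inserted pair is the first two letters of the
    block if \<open>x = y\<close>, and the last two if \<open>x = letter_inv y\<close>.\<close>
  have yreg: "fim_proj X (u @ [y, letter_inv y, y] @ v) = fim_proj X w"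
    using fim_proj_context[OF fim_proj_regular[of "[y]" X], of u v] by (simp add: d)
  from c show ?thesis
  proof
    assume "fg_proj X u = \<one>\<^bsub>FG X\<^esub> \<and> y = x"
    then show ?thesis using key[of u "[y] @ v"] yreg uv(2) by (simp add: d)
  next
    assume "fg_proj X (u @ [y]) = \<one>\<^bsub>FG X\<^esub> \<and> x = letter_inv y"
    then show ?thesis using key[of "u @ [y]" v] yreg by (simp add: d)
  qed
qed

text \<open>Mirror image of the left version: translation by the inverse of \<open>w\<close> moves
  its final vertex to the identity, as the initial vertex of \<open>word_inv w\<close>.\<close>

lemma fim_proj_absorb_right:
  assumes w: "w \<in> words X" and arc: "(fg_proj X w, x) \<in> munn_arcs X w" and x: "x \<in> letters X"
  shows "fim_proj X (w @ [x, letter_inv x]) = fim_proj X w"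
proof -
  note [simp] = w x
  have "translate X (word_inv w) (fg_proj X w, x) \<in> munn_arcs X (word_inv w)"
    using arc munn_arcs_word_inv[of "word_inv w" X] by auto
  then have "(\<one>\<^bsub>FG X\<^esub>, x) \<in> munn_arcs X (word_inv w)"
    using fg_proj_word_inv[of "word_inv w" X] by (simp add: translate_fg_proj)
  then have "fim_proj X ([x, letter_inv x] @ word_inv w) = fim_proj X (word_inv w)"
    by (intro fim_proj_absorb_left) simp_all
  then have "fim_proj X (word_inv ([x, letter_inv x] @ word_inv w)) = fim_proj X (word_inv (word_inv w))"
    by (intro fim_proj_word_inv_cong) simp_all
  then show ?thesis by simp
qed

section \<open>Trivial conjugacy classes\<close>

definition common_out_label :: "'a set \<Rightarrow> 'a letter list \<Rightarrow> 'a letter \<Rightarrow> bool" where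
  "common_out_label X w x \<longleftrightarrow> x \<in> letters X \<and>
    (\<one>\<^bsub>FG X\<^esub>, x) \<in> munn_arcs X w \<and> (fg_proj X w, x) \<in> munn_arcs X w"

lemma i_conj_refl:
  assumes "u \<in> words X"
  shows "i_conj (FIM X) (fim_proj X u) (fim_proj X u)"
proof -
  interpret monoid "FIM X" by (rule monoid_FIM)
  have "im_inv (FIM X) \<one>\<^bsub>FIM X\<^esub> = \<one>\<^bsub>FIM X\<^esub>"
    using im_inv_fim_proj[of "[]" X] by (simp add: fim_proj_Nil)
  then show ?thesis using assms unfolding i_conj_def
    by (intro conjI bexI[of _ "\<one>\<^bsub>FIM X\<^esub>"]) simp_all
qed

text \<open>If \<open>w\<close> and its conjugate by \<open>x\<close> had the same Munn tree, that finite tree would be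
  closed under left translation by the inverse of \<open>x\<close>, which has infinite order.\<close>

lemma fim_proj_conj_neq:
  assumes w: "w \<in> words X" and x: "common_out_label X w x"
  shows "fim_proj X ([letter_inv x] @ w @ [x]) \<noteq> fim_proj X w"
proof
  assume eq: "fim_proj X ([letter_inv x] @ w @ [x]) = fim_proj X w"
  have xl [simp]: "x \<in> letters X" using x by (simp add: common_out_label_def)
  have "munn_arcs X ([letter_inv x] @ w @ [x]) = munn_arcs X w"
    using munn_arcs_fim_cong[OF eq w] .
  then have closed: "translate X [letter_inv x] ` munn_arcs X w \<subseteq> munn_arcs X w"
    using w munn_arcs_append[of "[letter_inv x]" X "w @ [x]"] munn_arcs_append[of w X "[x]"]
    by auto
  have rw: "replicate n (letter_inv x) \<in> words X" for n by auto
  have "(fg_proj X (replicate n (letter_inv x)), x) \<in> munn_arcs X w" for n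
  proof (induction n)
    case 0
    then show ?case using x by (simp add: common_out_label_def fg_proj_Nil)
  next
    case (Suc n)
    then have "translate X [letter_inv x] (fg_proj X (replicate n (letter_inv x)), x) \<in> munn_arcs X w"
      using closed by blast
    then show ?case using rw[of n] by (subst (asm) translate_fg_proj) simp_all
  qed
  then have "range (\<lambda>n. (fg_proj X (replicate n (letter_inv x)), x)) \<subseteq> munn_arcs X w" by blast
  then have "finite (range (\<lambda>n. (fg_proj X (replicate n (letter_inv x)), x)))"
    using finite_munn_arcs[OF w] finite_subset by blast
  moreover have "inj (\<lambda>n. (fg_proj X (replicate n (letter_inv x)), x))"
  proof (rule injI)
    fix m n assume "(fg_proj X (replicate m (letter_inv x)), x) = (fg_proj X (replicate n (letter_inv x)), x)"
    then have "exponent_sum (letter_inv x) (replicate m (letter_inv x))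
        = exponent_sum (letter_inv x) (replicate n (letter_inv x))"
      using exponent_sum_fg_proj rw by blast
    moreover have "exponent_sum (letter_inv x) (replicate k (letter_inv x)) = int k" for k
      by (induction k) (simp_all add: exponent_sum_def)
    ultimately show "m = n" by simp
  qed
  ultimately show False using finite_imageD infinite_UNIV_nat by blast
qed

lemma conj_class_nontrivial_iff:
  assumes w: "w \<in> words X"
  shows "conj_class (FIM X) (fim_proj X w) \<noteq> {fim_proj X w} \<longleftrightarrow> (\<exists>x. common_out_label X w x)"
proof
  interpret monoid "FIM X" by (rule monoid_FIM)
  assume "conj_class (FIM X) (fim_proj X w) \<noteq> {fim_proj X w}"
  then obtain b where b: "i_conj (FIM X) (fim_proj X w) b" "b \<noteq> fim_proj X w"
    using i_conj_refl[OF w] by (auto simp: conj_class_def)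
  then obtain h where h: "h \<in> words X"
    and hb: "fim_proj X (word_inv h) \<otimes>\<^bsub>FIM X\<^esub> fim_proj X w \<otimes>\<^bsub>FIM X\<^esub> fim_proj X h = b"
    and ha: "fim_proj X h \<otimes>\<^bsub>FIM X\<^esub> b \<otimes>\<^bsub>FIM X\<^esub> fim_proj X (word_inv h) = fim_proj X w"
    by (auto simp: i_conj_def carrier_FIM im_inv_fim_proj)
  have "h \<noteq> []"
  proof
    assume "h = []"
    then show False using hb b(2) fim_proj_closed[OF w] by (simp add: fim_proj_Nil)
  qed
  then obtain x k where hx: "h = x # k" by (cases h) auto
  have [simp]: "x \<in> letters X" "k \<in> words X" using h hx by auto
  note [simp] = h w
  have "fim_proj X (h @ word_inv h @ w @ h @ word_inv h) = fim_proj X w"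
    using ha hb[symmetric] by (simp add: fim_proj_append m_assoc)
  then have eq: "munn_arcs X (h @ word_inv h @ w @ h @ word_inv h) = munn_arcs X w"
    by (rule munn_arcs_fim_cong) simp
  have hs: "(\<one>\<^bsub>FG X\<^esub>, x) \<in> munn_arcs X h" by (simp add: hx munn_arcs_Cons)
  \<comment> \<open>The copy of \<open>h\<close> after \<open>w\<close> is read from the final
    vertex, so its first arc starts there; the leading copy gives the arc at the identity.\<close>
  then have "translate X w (\<one>\<^bsub>FG X\<^esub>, x) \<in> munn_arcs X (w @ h @ word_inv h)"
    by (simp add: munn_arcs_append)
  then have "(fg_proj X w, x) \<in> munn_arcs X (w @ h @ word_inv h)"
    using translate_fg_proj[of w X "[]" x] by (simp add: fg_proj_Nil)
  then have "(fg_proj X w, x) \<in> munn_arcs X w" "(\<one>\<^bsub>FG X\<^esub>, x) \<in> munn_arcs X w"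
    using hs eq munn_arcs_idem[of h X "w @ h @ word_inv h"] by auto
  then have "common_out_label X w x" by (simp add: common_out_label_def)
  then show "\<exists>x. common_out_label X w x" ..
next
  assume "\<exists>x. common_out_label X w x"
  then obtain x where x: "common_out_label X w x" ..
  then have xl [simp]: "x \<in> letters X" by (simp add: common_out_label_def)
  note [simp] = w
  let ?b = "fim_proj X ([letter_inv x] @ w @ [x])"
  have "fim_proj X ([x, letter_inv x] @ w @ [x, letter_inv x]) = fim_proj X (w @ [x, letter_inv x])"
    using fim_proj_context[of X "[x, letter_inv x] @ w" w "[]" "[x, letter_inv x]"]
      fim_proj_absorb_left[OF w, of x] x
    by (simp add: common_out_label_def)
  also have "\<dots> = fim_proj X w"
    using fim_proj_absorb_right[OF w, of x] x by (simp add: common_out_label_def)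
  finally have "fim_proj X [x] \<otimes>\<^bsub>FIM X\<^esub> ?b \<otimes>\<^bsub>FIM X\<^esub> fim_proj X [letter_inv x] = fim_proj X w"
    using fim_proj_append[of "[x] @ [letter_inv x] @ w @ [x]" X "[letter_inv x]"]
      fim_proj_append[of "[x]" X "[letter_inv x] @ w @ [x]"]
    by simp
  moreover have "fim_proj X [letter_inv x] \<otimes>\<^bsub>FIM X\<^esub> fim_proj X w \<otimes>\<^bsub>FIM X\<^esub> fim_proj X [x] = ?b"
    using fim_proj_append[of "[letter_inv x] @ w" X "[x]"] fim_proj_append[of "[letter_inv x]" X w]
    by simp
  moreover have "im_inv (FIM X) (fim_proj X [x]) = fim_proj X [letter_inv x]"
    using im_inv_fim_proj[of "[x]" X] by simp
  ultimately have "i_conj (FIM X) (fim_proj X w) ?b"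
    unfolding i_conj_def by (intro conjI bexI[of _ "fim_proj X [x]"]) simp_all
  then show "conj_class (FIM X) (fim_proj X w) \<noteq> {fim_proj X w}"
    using fim_proj_conj_neq[OF w x] by (auto simp: conj_class_def)
qed

section \<open>Short words and the equivalence\<close>

text \<open>On a path of one letter \<open>y\<close>, only \<open>y\<close> leaves the start and
  only its inverse leaves the end. If \<open>z\<close> is not the inverse of \<open>y\<close>, the
  path of \<open>[y, z]\<close> has three distinct vertices; only \<open>y\<close> leaves the first
  and only \<open>letter_inv z\<close> the last.\<close>

lemma common_out_label_short:
  assumes w: "w \<in> words X" and x: "common_out_label X w x" and l: "length w \<le> 2"
  shows "\<exists>y. w = [y, letter_inv y]"
proof -
  have ne: "fg_proj X u \<noteq> fg_proj X v"
    if "exponent_sum y u \<noteq> exponent_sum y v" "v \<in> words X" for y u v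
    using that exponent_sum_fg_proj by blast
  have ne1: "fg_proj X (u @ [y]) \<noteq> fg_proj X u" if "u \<in> words X" for u y
    using that by (intro ne[where y = y]) (auto simp: exponent_sum_def)
  from l consider "w = []" | y where "w = [y]" | y z where "w = [y, z]"
    by (auto simp: le_Suc_eq length_Suc_conv numeral_2_eq_2)
  then show ?thesis
  proof cases
    case 1
    then show ?thesis using x by (simp add: common_out_label_def munn_arcs_Nil)
  next
    case 2
    then show ?thesis
      using x w ne1[of "[]" y]
      by (auto simp: common_out_label_def munn_arcs_Cons munn_arcs_Nil fg_proj_Nil)
  next
    case 3
    have z: "z = letter_inv y"
    proof (rule ccontr)
      assume z: "z \<noteq> letter_inv y"
      \<comment> \<open>The exponent sum of \<open>y\<close> is 1 or 2 on the left and 0 on the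
        right.\<close>
      then have "fg_proj X [y, z] \<noteq> fg_proj X []"
        by (intro ne[where y = y]) (auto simp: exponent_sum_def)
      moreover have "munn_arcs X w =
          {(fg_proj X [], y), (fg_proj X [y], letter_inv y), (fg_proj X [y], z),
            (fg_proj X [y, z], letter_inv z)}"
        using w translate_fg_proj[of "[y]" X "[]"] translate_fg_proj[of "[y]" X "[z]"]
        by (simp add: 3 munn_arcs_Cons munn_arcs_Nil fg_proj_Nil insert_commute)
      ultimately show False
        using x w z ne1[of "[]" y] ne1[of "[y]" z]
        by (auto simp: 3 common_out_label_def simp flip: fg_proj_Nil)
    qed
    with 3 show ?thesis by simp
  qed
qed

text \<open>Initial and final vertex coincide here, so one arc serves for both. This bounds the
  minimal length over nontrivial classes by 2.\<close>

lemma common_out_label_idem: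
  "x \<in> letters X \<Longrightarrow> common_out_label X [x, letter_inv x] x"
  using fg_proj_cancel[of "[]" X x]
  by (simp add: common_out_label_def munn_arcs_Cons fg_proj_Nil)

lemma ex_Geo:
  assumes "u \<in> words X"
  obtains v where "v \<in> Geo X" "fim_proj X v = fim_proj X u" "length v \<le> length u"
proof -
  define v where "v = arg_min length (\<lambda>v. v \<in> words X \<and> fim_proj X v = fim_proj X u)"
  have "v \<in> words X \<and> fim_proj X v = fim_proj X u"
    unfolding v_def by (rule arg_min_natI[of _ u]) (simp add: assms)
  moreover have "length v \<le> length t" if "t \<in> words X" "fim_proj X t = fim_proj X u" for t
    unfolding v_def by (rule arg_min_nat_le) (simp add: that)
  ultimately show ?thesis using assms by (intro that[of v]) (simp_all add: Geo_def)
qed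

theorem proposition4p3:
  fixes X :: "'a set" and w :: "'a letter list"
  assumes "finite X" and "w \<in> Geo X"
  shows "w \<in> UConjGeo X \<longleftrightarrow>
    (length w = 2 \<and> fim_proj X w \<otimes>\<^bsub>FIM X\<^esub> fim_proj X w = fim_proj X w) \<or>
    \<not> (\<exists>x \<in> letters X.
        (\<exists>e \<in> arcs (munn_tree X w). label e = x \<and> tail (munn_tree X w) e = initial_vertex X w) \<and>
        (\<exists>e \<in> arcs (munn_tree X w). label e = x \<and> tail (munn_tree X w) e = final_vertex X w))"
    (is "_ \<longleftrightarrow> ?idem \<or> \<not> ?common")
proof -
  have w: "w \<in> words X" using assms(2) by (simp add: Geo_def)
  have words: "u \<in> words X" if "u \<in> Geo X" for u using that by (simp add: Geo_def)
  have tail: "tail (munn_tree X w) = fst" by (simp add: munn_tree_def cayley_graph_def)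
  have common: "?common \<longleftrightarrow> (\<exists>x. common_out_label X w x)"
    unfolding common_out_label_def initial_vertex_def final_vertex_def tail by force
  have UConj: "(fim_proj X w, fim_proj X u) \<in> UConj (FIM X) \<longleftrightarrow>
      fim_proj X w = fim_proj X u \<or>
      ?common \<and> (\<exists>x. common_out_label X u x)" if "u \<in> Geo X" for u
    unfolding UConj_def common
    using w words[OF that] by (simp add: conj_class_nontrivial_iff)
  have Geo: "length w \<le> length u" if "u \<in> Geo X" "fim_proj X w = fim_proj X u" for u
    using that assms(2) by (simp add: Geo_def)
  show ?thesis
  proof
    assume U: "w \<in> UConjGeo X"
    have ?idem if c: ?common
    proof -
      from c obtain x where x: "common_out_label X w x" using common by blast
      then have xl: "x \<in> letters X" by (simp add: common_out_label_def)
      \<comment> \<open>\<open>UConjGeo\<close> compares with geodesics only; passing to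
        \<open>v\<close> avoids proving that \<open>[x, letter_inv x]\<close> is one.\<close>
      then obtain v where v: "v \<in> Geo X" "fim_proj X v = fim_proj X [x, letter_inv x]"
          "length v \<le> length [x, letter_inv x]"
        using ex_Geo[of "[x, letter_inv x]" X] by (metis Cons_in_lists_iff letter_inv_in_letters lists.Nil)
      have "\<exists>y. common_out_label X [x, letter_inv x] y" using common_out_label_idem[OF xl] ..
      \<comment> \<open>The conjugacy class depends only on the element, so the property passes
        between words representing it.\<close>
      then have "\<exists>y. common_out_label X v y"
        using xl conj_class_nontrivial_iff[OF words[OF v(1)]]
          conj_class_nontrivial_iff[of "[x, letter_inv x]" X]
        by (simp add: v(2))
      then have "(fim_proj X w, fim_proj X v) \<in> UConj (FIM X)" using c UConj[OF v(1)] by blast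
      then have "length w \<le> length v" using U v(1) unfolding UConjGeo_def by blast
      then have "length w \<le> 2" using v(3) by simp
      then obtain y where y: "w = [y, letter_inv y]"
        using common_out_label_short[OF w x] by blast
      then show ?idem
        using w fim_proj_context[OF fim_proj_regular[of "[y]" X], of "[]" "[letter_inv y]"]
          fim_proj_append[of w X w]
        by simp
    qed
    then show "?idem \<or> \<not> ?common" by blast
  next
    assume R: "?idem \<or> \<not> ?common"
    have "length w \<le> length u"
      if u: "u \<in> Geo X" and c: "?common" and x: "common_out_label X u x" for u x
    proof (rule ccontr)
      \<comment> \<open>As \<open>?common\<close> holds, \<open>w\<close> has length 2. A shorter
        \<open>u\<close> would have the form \<open>[y, letter_inv y]\<close>, again of length
        2.\<close>
      assume "\<not> length w \<le> length u"
      then show False using R c common_out_label_short[OF words[OF u] x] by auto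
    qed
    then show "w \<in> UConjGeo X" using Geo UConj assms(2) unfolding UConjGeo_def by blast
  qed
qed

end
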